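(* The basis $\mathcal{R}_0=\{t+V_m\colon m\in\mathbb{N},\ t\in H_m\}$ differentiates $L^1(\mathbb{T}^\omega)$. That is, for every $f\in L^1(\mathbb{T}^\omega)$ one has $\overline{D}\bigl(\int\! f,x\bigr)=\underline{D}\bigl(\int\! f,x\bigr)=f(x)$ for almost every $x\in\mathbb{T}^\omega$, where the upper and lower derivatives are taken with respect to $\mathcal{R}_0$.
   Context: $\mathbb{T}=\mathbb{R}/\mathbb{Z}$ is identified with $[0,1)$. $\mathbb{T}^\omega$ is the compact abelian group given by the product of countably infinitely many copies of $\mathbb{T}$, with the product topology and coordinatewise addition mod 1. $m$ (or $dx$) is its Haar measure normalized by $m(\mathbb{T}^\omega)=1$, i.e. the product of the Lebesgue measures. For $n\in\mathbb{N}=\{1,2,\dots\}$ write $\mathbb{T}^\omega=\mathbb{T}^n\times\mathbb{T}^{n,\omega}$, where $\mathbb{T}^{n,\omega}$ is the copy of the infinite torus with coordinates $x_{n+1},x_{n+2},\dots$, and let $\bar 0^{(n}$ denote its zero element. The metric is $d(x,y)=\sum_{n=1}^\infty |x_n-y_n|/2^n$, and $\delta(S)=\sup_{x,y\in S}d(x,y)$ is the diameter of $S\subset\mathbb{T}^\omega$. For $k\in\mathbb{N}$ let $R_k=\{0,\frac1k,\dots,\frac{k-1}k\}\subset\mathbb{T}$. Define finite subgroups $H_m$ and open sets $V_m$ of $\mathbb{T}^\omega$, $m\in\mathbb{N}$, by $H_1=R_2\times\{\bar 0^{(1}\}$, $V_1=(0,\frac12)\times\mathbb{T}^{1,\omega}$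 and, for $n\ge1$ and $1\le j\le 2n+1$, $H_{n^2+j}=\widetilde H_{n^2+j}\times\{\bar0^{(n+1}\}$ and $V_{n^2+j}=\widetilde V_{n^2+j}\times\mathbb{T}^{n+1,\omega}$, where: - if $1\le j\le n$: $\widetilde H_{n^2+j}=(R_{2^n})^n\times R_{2^j}$ and $\widetilde V_{n^2+j}=(0,\frac1{2^n})^n\times(0,\frac1{2^j})$; - if $n+1\le j\le 2n+1$: $\widetilde H_{n^2+j}=(R_{2^{n+1}})^{j-n}\times(R_{2^n})^{2n+1-j}$ and $\widetilde V_{n^2+j}=(0,\frac1{2^{n+1}})^{j-n}\times(0,\frac1{2^n})^{2n+1-j}$. Differentiation: let $\mathcal{B}$ be a family of measurable sets of positive measure. For $x\in\mathbb{T}^\omega$ let $\mathcal{B}(x)$ be the collection of sets in $\mathcal{B}$ whose topological closures contain $x$. For a sequence $\{B_n\}\subset\mathcal{B}(x)$, write $B_n\Rightarrow x$ if $\delta(B_n)\to0$. With $f_B=\frac1{m(B)}\int_B f\,dm$, for $f\in L^1(\mathbb{T}^\omega)$ (taken real-valued without loss of generality) put $$\overline{D}\bigl(\textstyle\int\! f,x\bigr)=\sup_{B_n\Rightarrow x}\ \limsup_n f_{B_n},\qquad \underline{D}\bigl(\textstyle\int\! f,x\bigr)=\inf_{B_n\Rightarrow x}\ \liminf_n f_{B_n},$$ the sup and inf being over all sequences $\{B_n\}\subset\mathcal{B}(x)$ with $B_n\Rightarrow x$. *)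

theory Defs
  imports
    "HOL-Probability.Probability"
    "HOL-Library.Function_Algebras"
    "HOL-Library.Discrete_Functions"
begin

section \<open>The circle group\<close>

quotient_type circle = real / "\<lambda>x y::real. x - y \<in> \<int>"
  morphisms rep_circle circle_of
proof (rule equivpI)
  show "reflp (\<lambda>x y::real. x - y \<in> \<int>)" by (simp add: reflp_def)
  show "symp (\<lambda>x y::real. x - y \<in> \<int>)"
    by (metis (no_types, lifting) Ints_minus minus_diff_eq sympI)
  show "transp (\<lambda>x y::real. x - y \<in> \<int>)"
  proof (rule transpI)
    fix x y z :: real
    assume "x - y \<in> \<int>" "y - z \<in> \<int>"
    then have "(x - y) + (y - z) \<in> \<int>" by (rule Ints_add)
    then show "x - z \<in> \<int>" by simp
  qed
qed

instantiation circle :: ab_group_add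
begin

lift_definition zero_circle :: circle is 0 .

lift_definition plus_circle :: "circle \<Rightarrow> circle \<Rightarrow> circle" is "(+)"
proof -
  fix a b c d :: real
  assume "a - b \<in> \<int>" "c - d \<in> \<int>"
  then have "(a - b) + (c - d) \<in> \<int>" by (rule Ints_add)
  then show "(a + c) - (b + d) \<in> \<int>" by (simp add: algebra_simps)
qed

lift_definition uminus_circle :: "circle \<Rightarrow> circle" is uminus
  by (metis Ints_minus minus_diff_minus)

lift_definition minus_circle :: "circle \<Rightarrow> circle \<Rightarrow> circle" is "(-)"
proof -
  fix a b c d :: real
  assume "a - b \<in> \<int>" "c - d \<in> \<int>"
  then have "(a - b) - (c - d) \<in> \<int>" by (rule Ints_diff)
  then show "(a - c) - (b - d) \<in> \<int>" by (simp add: algebra_simps)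
qed

instance
  by standard (transfer; simp add: algebra_simps)+

end

text \<open>The quotient topology.\<close>

instantiation circle :: topological_space
begin

definition open_circle :: "circle set \<Rightarrow> bool"
  where "open_circle U \<longleftrightarrow> open (circle_of -` U)"

instance
  by standard (auto simp: open_circle_def vimage_Union)

end

lemma continuous_on_circle_of: "continuous_on A circle_of"
  by (rule continuous_on_subset[of UNIV])
     (simp_all add: continuous_on_open_vimage open_circle_def)

lemma measurable_circle_of [measurable]: "circle_of \<in> borel_measurable borel"
  by (rule borel_measurable_continuous_onI) (rule continuous_on_circle_of)

text \<open>The quotient norm, that is, the distance of a representative to the nearest integer.\<close>

definition circle_norm :: "circle \<Rightarrow> real"
  where "circle_norm x = (INF r \<in> {r. circle_of r = x}. \<bar>r\<bar>)"

definition circle_measure :: "circle measure"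
  where "circle_measure = distr (restrict_space lborel {0..<1}) borel circle_of"

lemma prob_space_circle_measure: "prob_space circle_measure"
  unfolding circle_measure_def
proof (rule prob_space.prob_space_distr)
  show "prob_space (restrict_space lborel {0..<1::real})"
    by (rule prob_spaceI) (simp add: emeasure_restrict_space)
  show "circle_of \<in> restrict_space lborel {0..<1} \<rightarrow>\<^sub>M borel"
    by (rule measurable_restrict_space1) simp
qed


section \<open>The infinite torus\<close>

text \<open>
  The coordinate written \<open>x\<^sub>n\<close>, \<open>n \<ge> 1\<close>, in the mathematical text is \<open>x (n - 1)\<close> here.
  Topology and addition are the library's product topology and pointwise addition on functions.
\<close>

type_synonym torus = "nat \<Rightarrow> circle"

definition haar :: "torus measure"
  where "haar = PiM UNIV (\<lambda>_. circle_measure)"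

lemma prob_space_haar: "prob_space haar"
  unfolding haar_def by (intro prob_space_PiM prob_space_circle_measure)

definition torus_dist :: "torus \<Rightarrow> torus \<Rightarrow> real"
  where "torus_dist x y = (\<Sum>i. circle_norm (x i - y i) / 2 ^ Suc i)"

definition torus_diameter :: "torus set \<Rightarrow> real"
  where "torus_diameter S = (SUP (x, y) \<in> S \<times> S. torus_dist x y)"


section \<open>Differentiation of integrals\<close>

definition basis_at :: "torus set set \<Rightarrow> torus \<Rightarrow> torus set set"
  where "basis_at \<B> x = {B \<in> \<B>. x \<in> closure B}"

definition contracting :: "torus set set \<Rightarrow> torus \<Rightarrow> (nat \<Rightarrow> torus set) set"
  where "contracting \<B> x =
    {B. (\<forall>n. B n \<in> basis_at \<B> x) \<and> (\<lambda>n. torus_diameter (B n)) \<longlonglongrightarrow> 0}"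

definition average :: "(torus \<Rightarrow> real) \<Rightarrow> torus set \<Rightarrow> real"
  where "average f B = (LINT x:B|haar. f x) / measure haar B"

definition upper_derivative :: "torus set set \<Rightarrow> (torus \<Rightarrow> real) \<Rightarrow> torus \<Rightarrow> ereal"
  where "upper_derivative \<B> f x =
    (SUP B \<in> contracting \<B> x. limsup (\<lambda>n. ereal (average f (B n))))"

definition lower_derivative :: "torus set set \<Rightarrow> (torus \<Rightarrow> real) \<Rightarrow> torus \<Rightarrow> ereal"
  where "lower_derivative \<B> f x =
    (INF B \<in> contracting \<B> x. liminf (\<lambda>n. ereal (average f (B n))))"


section \<open>The basis of translated boxes\<close>

text \<open>
  A list \<open>[k\<^sub>1, \<dots>, k\<^sub>N]\<close> encodes the subgroup \<open>R\<^bsub>k\<^sub>1\<^esub> \<times> \<dots> \<times> R\<^bsub>k\<^sub>N\<^esub> \<times> {0}\<close>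
  and the open set \<open>(0, 1/k\<^sub>1) \<times> \<dots> \<times> (0, 1/k\<^sub>N) \<times> T \<times> T \<times> \<dots>\<close>.
\<close>

definition R :: "nat \<Rightarrow> circle set"
  where "R k = {circle_of (real i / real k) | i. i < k}"

definition box_subgroup :: "nat list \<Rightarrow> torus set"
  where "box_subgroup ks =
    {t. (\<forall>i<length ks. t i \<in> R (ks ! i)) \<and> (\<forall>i\<ge>length ks. t i = 0)}"

definition box_open :: "nat list \<Rightarrow> torus set"
  where "box_open ks = {x. \<forall>i<length ks. x i \<in> circle_of ` {0<..<1 / real (ks ! i)}}"

text \<open>
  Every \<open>m \<ge> 2\<close> is uniquely \<open>n\<^sup>2 + j\<close> with \<open>n \<ge> 1\<close> and \<open>1 \<le> j \<le> 2n + 1\<close>,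
  and then \<open>n\<close> is the integer part of the square root of \<open>m - 1\<close>.
\<close>

definition denominators :: "nat \<Rightarrow> nat list"
  where "denominators m =
    (if m = 1 then [2]
     else let n = floor_sqrt (m - 1); j = m - n\<^sup>2 in
       if j \<le> n then replicate n (2 ^ n) @ [2 ^ j]
       else replicate (j - n) (2 ^ (n + 1)) @ replicate (2 * n + 1 - j) (2 ^ n))"

lemma denominators_square_add:
  assumes "1 \<le> n" "1 \<le> j" "j \<le> 2 * n + 1"
  shows "denominators (n\<^sup>2 + j) =
    (if j \<le> n then replicate n (2 ^ n) @ [2 ^ j]
     else replicate (j - n) (2 ^ (n + 1)) @ replicate (2 * n + 1 - j) (2 ^ n))"
proof -
  have "floor_sqrt (n\<^sup>2 + j - 1) = n"
    by (rule floor_sqrt_unique) (use assms in \<open>auto simp: power2_eq_square\<close>)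
  moreover have "n\<^sup>2 + j \<noteq> 1"
    using assms one_le_power[of n 2] by linarith
  ultimately show ?thesis
    by (simp add: denominators_def Let_def)
qed

definition H :: "nat \<Rightarrow> torus set"
  where "H m = box_subgroup (denominators m)"

definition V :: "nat \<Rightarrow> torus set"
  where "V m = box_open (denominators m)"

definition R0 :: "torus set set"
  where "R0 = {(\<lambda>v. t + v) ` V m | m t. 1 \<le> m \<and> t \<in> H m}"

end

theory Submission
  imports Defs
begin

text \<open>
  The subgroups \<open>H\<^sub>m\<close> are nested, so the translates of \<open>V\<^sub>m\<close> by \<open>H\<^sub>m\<close> form, up to null sets,
  a refining sequence of finite partitions of the torus, and averaging over the cells of a
  generation is a martingale. Off the null set of points having a dyadic coordinate, a point lies
  in the closure of exactly one cell of each generation, so the sequences contracting to it are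
  precisely its cells along generations tending to infinity. Convergence of the averages follows
  from the weak type maximal inequality and the \<open>L\<^sup>1\<close>-density of the functions that are constant
  on the cells of some generation.
\<close>

section \<open>Differentiation along refining partitions\<close>

text \<open>The boxes of one generation are open and leave out their common walls, so they do not
  partition the torus exactly. The martingale part therefore works with the fibres of a label, which
  form a genuine partition, and the open boxes return only when averages are compared almost
  everywhere. Nestedness comes from the numbering of the boxes: passing from \<open>m\<close> to
  \<open>m + 1\<close> halves exactly one side. Two cells are thus nested or disjoint, which
  replaces any covering lemma, gives the maximal inequality with constant 1 and makes the cells a
  pi-system for the density argument. Two features of the metric matter in the end: every box leaves
  infinitely many coordinates free and so has positive diameter, while in each fixed coordinate the
  sides shrink to 0.\<close>

locale refining_labels = prob_space M for M :: "'a measure" +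
  fixes label :: "nat \<Rightarrow> 'a \<Rightarrow> 'b"
  assumes cell_sets: "\<And>m x. x \<in> space M \<Longrightarrow> {y \<in> space M. label m y = label m x} \<in> sets M"
    and finite_labels: "\<And>m. finite (label m ` space M)"
    and refine: "\<And>m x y. x \<in> space M \<Longrightarrow> y \<in> space M \<Longrightarrow>
      label (Suc m) x = label (Suc m) y \<Longrightarrow> label m x = label m y"
    and generated: "sets M \<subseteq> sigma_sets (space M)
      {{y \<in> space M. label m y = label m x} | m x. x \<in> space M}"
begin

section \<open>Cells and functions constant on cells\<close>

definition cell :: "nat \<Rightarrow> 'a \<Rightarrow> 'a set"
  where "cell m x = {y \<in> space M. label m y = label m x}"

text \<open>This is a version of the conditional expectation of \<open>f\<close> given the finite
  algebra of generation \<open>m\<close>. On a null cell the quotient is 0 by the convention for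
  division; \<open>AE_cell_pos\<close> discards such cells.\<close>

definition cell_average :: "nat \<Rightarrow> ('a \<Rightarrow> real) \<Rightarrow> 'a \<Rightarrow> real"
  where "cell_average m f x = (LINT y:cell m x|M. f y) / prob (cell m x)"

text \<open>As there are finitely many labels, this amounts to measurability for the algebra of
  generation \<open>m\<close>. The range type is arbitrary so that membership predicates are covered
  along with real functions.\<close>

definition level :: "nat \<Rightarrow> ('a \<Rightarrow> 'c) \<Rightarrow> bool"
  where "level m h \<longleftrightarrow> (\<forall>x\<in>space M. \<forall>y\<in>space M. label m x = label m y \<longrightarrow> h x = h y)"

lemma levelD:
  assumes "level m h" "x \<in> space M" "y \<in> space M" "label m x = label m y"
  shows "h x = h y"
  using assms unfolding level_def by metis

lemma level_compose2:
  assumes "level m h" "level m k"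
  shows "level m (\<lambda>x. F (h x) (k x))"
  unfolding level_def using assms[THEN levelD] by metis

lemma cell_in_sets [measurable]: "x \<in> space M \<Longrightarrow> cell m x \<in> sets M"
  using cell_sets by (simp add: cell_def)

lemma cell_self: "x \<in> space M \<Longrightarrow> x \<in> cell m x"
  by (simp add: cell_def)

lemma finite_cells: "finite (cell m ` space M)"
proof -
  have "cell m ` space M = (\<lambda>b. {y \<in> space M. label m y = b}) ` label m ` space M"
    by (auto simp: cell_def image_image)
  then show ?thesis
    using finite_labels by simp
qed

lemma label_mono:
  assumes "m \<le> n" "x \<in> space M" "y \<in> space M" "label n x = label n y"
  shows "label m x = label m y"
  using assms(1,4)
proof (induction rule: dec_induct)
  case (step k)
  then show ?case using refine assms(2,3) by metis
qed

lemma cell_antimono: "m \<le> n \<Longrightarrow> x \<in> space M \<Longrightarrow> cell n x \<subseteq> cell m x"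
  unfolding cell_def by (blast intro: label_mono)

lemma level_mono: "level m h \<Longrightarrow> m \<le> n \<Longrightarrow> level n h"
  unfolding level_def by (metis label_mono)

lemma level_set_eq_Union_cells:
  assumes "level m (\<lambda>x. x \<in> A)" "A \<subseteq> space M"
  shows "A = \<Union>(cell m ` A)"
proof (intro equalityI subsetI)
  fix x assume "x \<in> A"
  then show "x \<in> \<Union>(cell m ` A)"
    using cell_self[of x m] assms(2) by blast
next
  fix x assume "x \<in> \<Union>(cell m ` A)"
  then obtain y where "y \<in> A" "x \<in> space M" "label m x = label m y"
    by (auto simp: cell_def)
  then show "x \<in> A"
    using assms unfolding level_def by blast
qed

lemma level_sets:
  assumes "level m (\<lambda>x. x \<in> A)" "A \<subseteq> space M"
  shows "A \<in> sets M"
proof -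
  have "A = \<Union>(cell m ` A)"
    using assms by (rule level_set_eq_Union_cells)
  moreover have "\<Union>(cell m ` A) \<in> sets M"
    using assms(2) by (intro sets.finite_Union finite_subset[OF image_mono finite_cells]) auto
  ultimately show ?thesis
    by simp
qed

lemma level_measurable:
  fixes h :: "'a \<Rightarrow> real"
  assumes "level m h"
  shows "h \<in> borel_measurable M"
proof (rule measurableI)
  fix S :: "real set"
  have "level m (\<lambda>x. x \<in> h -` S \<inter> space M)"
    unfolding level_def
  proof (intro ballI impI)
    fix x y assume xy: "x \<in> space M" "y \<in> space M" "label m x = label m y"
    then have "h x = h y"
      using assms unfolding level_def by blast
    with xy show "x \<in> h -` S \<inter> space M \<longleftrightarrow> y \<in> h -` S \<inter> space M"
      by simp
  qed
  then show "h -` S \<inter> space M \<in> sets M"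
    by (rule level_sets) simp
qed simp

text \<open>A level function factors through the label: \<open>inv_into\<close> picks one
  representative point per label, and the value there is the value on the whole cell.\<close>

lemma level_finite_range:
  assumes "level m h"
  shows "finite (h ` space M)"
proof -
  have "h x = h (inv_into (space M) (label m) (label m x))" if "x \<in> space M" for x
    using assms[unfolded level_def, rule_format, of x "inv_into (space M) (label m) (label m x)"]
      that inv_into_into[of "label m x" "label m" "space M"]
    by (simp add: f_inv_into_f)
  then have "h ` space M \<subseteq> (\<lambda>b. h (inv_into (space M) (label m) b)) ` label m ` space M"
    by auto
  then show ?thesis
    using finite_labels finite_surj by blast
qed

lemma level_integrable:
  fixes h :: "'a \<Rightarrow> real"
  assumes "level m h"
  shows "integrable M h"
proof (rule integrable_const_bound[where B = "\<Sum>r\<in>h ` space M. \<bar>r\<bar>"])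
  show "AE x in M. norm (h x) \<le> (\<Sum>r\<in>h ` space M. \<bar>r\<bar>)"
    using level_finite_range[OF assms] member_le_sum[of _ "h ` space M" abs]
    by (intro AE_I2) auto
qed (rule level_measurable[OF assms])

lemma level_cell_average: "level m (cell_average m f)"
  by (simp add: level_def cell_average_def cell_def)

lemma cell_average_measurable [measurable]: "cell_average m f \<in> borel_measurable M"
  using level_cell_average by (rule level_measurable)

section \<open>The weak type maximal inequality\<close>

lemma set_integrable_of_integrable:
  fixes f :: "'a \<Rightarrow> real"
  assumes "integrable M f" "A \<in> sets M"
  shows "set_integrable M A f"
  using assms by (simp add: set_integrable_def integrable_real_mult_indicator mult.commute)

text \<open>The set is a finite disjoint union of cells of one generation, so the bound on each cell
  can be summed.\<close>

lemma set_integral_level_ge: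
  fixes g :: "'a \<Rightarrow> real"
  assumes g: "integrable M g" and lvl: "level m (\<lambda>x. x \<in> A)" and A: "A \<subseteq> space M"
    and avg: "\<And>x. x \<in> A \<Longrightarrow> c < cell_average m g x" and c: "0 \<le> c"
  shows "c * prob A \<le> (LINT x:A|M. g x)"
proof -
  let ?C = "cell m ` A"
  have eq: "A = (\<Union>B\<in>?C. B)"
    using level_set_eq_Union_cells[OF lvl A] by simp
  have fin: "finite ?C"
    using finite_subset[OF image_mono finite_cells] A .
  have disj: "disjoint_family_on (\<lambda>B. B) ?C"
    by (auto simp: disjoint_family_on_def cell_def)
  have C: "B \<in> sets M" if "B \<in> ?C" for B
    using that A by auto
  have "c * prob A = (\<Sum>B\<in>?C. c * prob B)"
    using finite_measure_finite_Union[OF fin _ disj] C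
    by (subst eq, subst finite_measure_finite_Union[OF fin _ disj]) (auto simp: sum_distrib_left)
  also have "\<dots> \<le> (\<Sum>B\<in>?C. LINT x:B|M. g x)"
  proof (rule sum_mono)
    fix B assume "B \<in> ?C"
    then obtain x where x: "x \<in> A" "B = cell m x" by auto
    have less: "c < (LINT y:B|M. g y) / prob B"
      using avg[OF x(1)] x(2) by (simp add: cell_average_def)
    \<comment> \<open>On a null cell the average would be 0, which cannot exceed the nonnegative
      \<open>c\<close>.\<close>
    then have "prob B \<noteq> 0"
      using c by auto
    then have "0 < prob B"
      by (simp add: zero_less_measure_iff)
    with less show "c * prob B \<le> (LINT x:B|M. g x)"
      by (simp add: pos_less_divide_eq)
  qed
  also have "\<dots> = (LINT x:(\<Union>B\<in>?C. B)|M. g x)"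
    using fin disj C by (subst set_integral_finite_Union) (auto intro!: set_integrable_of_integrable[OF g])
  finally show ?thesis
    using eq by simp
qed

text \<open>Decompose according to the first level at which the average exceeds \<open>c\<close>.\<close>

lemma maximal_inequality:
  fixes g :: "'a \<Rightarrow> real"
  assumes g: "integrable M g" "\<And>x. 0 \<le> g x" and c: "0 \<le> c"
  shows "c * prob {x \<in> space M. \<exists>m. c < cell_average m g x} \<le> (LINT x|M. g x)"
proof -
  define A where "A m = {x \<in> space M. c < cell_average m g x \<and> (\<forall>k<m. cell_average k g x \<le> c)}" for m
  have sets_A [measurable]: "A m \<in> sets M" for m
    unfolding A_def by measurable
  have disj: "disjoint_family A"
  proof -
    have "A m \<inter> A n = {}" if "m < n" for m n
      using that by (auto simp: A_def)
    then show ?thesis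
      unfolding disjoint_family_on_def by (metis Int_commute linorder_neqE_nat)
  qed
  \<comment> \<open>Membership in \<open>A m\<close> depends only on averages of generations up to
    \<open>m\<close>, and nesting makes all of these constant on cells of generation
    \<open>m\<close>.\<close>
  have lvl: "level m (\<lambda>x. x \<in> A m)" for m
    unfolding level_def
  proof (intro ballI impI)
    fix x y assume xy: "x \<in> space M" "y \<in> space M" "label m x = label m y"
    then have "cell_average k g x = cell_average k g y" if "k \<le> m" for k
      using levelD[OF level_mono[OF level_cell_average that]] by blast
    with xy show "x \<in> A m \<longleftrightarrow> y \<in> A m"
      by (simp add: A_def)
  qed
  have Un: "{x \<in> space M. \<exists>m. c < cell_average m g x} = (\<Union>m. A m)"
  proof -
    have "\<exists>m. x \<in> A m" if "x \<in> space M" "c < cell_average m g x" for x m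
      using that exists_least_iff[of "\<lambda>m. c < cell_average m g x"]
      unfolding A_def by (auto simp: not_less)
    then show ?thesis by (auto simp: A_def)
  qed
  have sums: "(\<lambda>m. c * prob (A m)) sums (c * prob (\<Union>m. A m))"
    using disj sets_A by (intro sums_mult finite_measure_UNION) auto
  have "(\<Sum>m<N. c * prob (A m)) \<le> (LINT x|M. g x)" for N
  proof -
    have "(\<Sum>m<N. c * prob (A m)) \<le> (\<Sum>m<N. LINT x:A m|M. g x)"
      by (intro sum_mono set_integral_level_ge[OF g(1) lvl])
         (use c in \<open>auto simp: A_def\<close>)
    also have "\<dots> = (LINT x:(\<Union>m<N. A m)|M. g x)"
      using disj by (subst set_integral_finite_Union)
        (auto intro!: set_integrable_of_integrable[OF g(1)] simp: disjoint_family_on_def)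
    \<comment> \<open>Nonnegativity of \<open>g\<close> allows the domain to be enlarged to the
      whole space, with a bound independent of \<open>N\<close>.\<close>
    also have "\<dots> \<le> (LINT x|M. g x)"
      unfolding set_lebesgue_integral_def
      using set_integrable_of_integrable[OF g(1), of "\<Union>m<N. A m"] g
      by (intro integral_mono) (auto simp: set_integrable_def indicator_def)
    finally show ?thesis .
  qed
  then have "c * prob (\<Union>m. A m) \<le> (LINT x|M. g x)"
    using sums suminf_le_const[of "\<lambda>m. c * prob (A m)"] by (auto simp: sums_iff)
  then show ?thesis
    by (simp add: Un)
qed

section \<open>Density of level functions in the space of integrable functions\<close>

text \<open>Membership in the \<open>L^1\<close> closure of the level functions of all generations,
  stated as a predicate so that it can be carried through induction on sets and on integrable
  functions.\<close>

definition approximable :: "('a \<Rightarrow> real) \<Rightarrow> bool"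
  where "approximable f \<longleftrightarrow> integrable M f \<and>
    (\<forall>e>0. \<exists>m h. level m h \<and> (LINT x|M. \<bar>f x - h x\<bar>) < e)"

lemma approximable_level: "level m f \<Longrightarrow> approximable f"
  unfolding approximable_def using level_integrable by fastforce

lemma approximable_add:
  assumes "approximable f" "approximable g"
  shows "approximable (\<lambda>x. f x + g x)"
  unfolding approximable_def
proof (intro conjI allI impI)
  show int: "integrable M (\<lambda>x. f x + g x)"
    using assms by (simp add: approximable_def)
  fix e :: real assume "0 < e"
  then obtain m h n k where hk: "level m h" "(LINT x|M. \<bar>f x - h x\<bar>) < e / 2"
    "level n k" "(LINT x|M. \<bar>g x - k x\<bar>) < e / 2"
    using assms unfolding approximable_def by (meson half_gt_zero)
  let ?l = "\<lambda>x. h x + k x"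
  \<comment> \<open>Both approximants are constant on the cells of the finer of the two
    generations.\<close>
  have "level (max m n) h" "level (max m n) k"
    using level_mono[OF hk(1)] level_mono[OF hk(3)] by auto
  then have lvl: "level (max m n) ?l"
    by (rule level_compose2)
  have "integrable M f" "integrable M g" "integrable M h" "integrable M k"
    using assms hk level_integrable by (auto simp: approximable_def)
  then have "(LINT x|M. \<bar>f x + g x - ?l x\<bar>) \<le> (LINT x|M. \<bar>f x - h x\<bar> + \<bar>g x - k x\<bar>)"
    by (intro integral_mono) auto
  also have "\<dots> = (LINT x|M. \<bar>f x - h x\<bar>) + (LINT x|M. \<bar>g x - k x\<bar>)"
    using \<open>integrable M f\<close> \<open>integrable M g\<close> \<open>integrable M h\<close> \<open>integrable M k\<close>
    by (intro Bochner_Integration.integral_add) auto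
  also have "\<dots> < e"
    using hk by simp
  finally show "\<exists>m h. level m h \<and> (LINT x|M. \<bar>f x + g x - h x\<bar>) < e"
    using lvl by blast
qed

lemma approximable_scale:
  assumes "approximable f"
  shows "approximable (\<lambda>x. c * f x)"
  unfolding approximable_def
proof (intro conjI allI impI)
  show int: "integrable M (\<lambda>x. c * f x)"
    using assms by (simp add: approximable_def)
  fix e :: real assume "0 < e"
  \<comment> \<open>The summand 1 keeps the denominator positive when \<open>c\<close> is 0.\<close>
  then have "0 < e / (\<bar>c\<bar> + 1)"
    by simp
  then obtain m h where h: "level m h" "(LINT x|M. \<bar>f x - h x\<bar>) < e / (\<bar>c\<bar> + 1)"
    using assms unfolding approximable_def by meson
  have "level m (\<lambda>x. c * h x)"
    by (rule level_compose2[OF h(1) h(1), of "\<lambda>a _. c * a"])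
  moreover have "(LINT x|M. \<bar>c * f x - c * h x\<bar>) < e"
  proof -
    have "\<bar>c * f x - c * h x\<bar> = \<bar>c\<bar> * \<bar>f x - h x\<bar>" for x
      by (metis abs_mult right_diff_distrib)
    then have "(LINT x|M. \<bar>c * f x - c * h x\<bar>) = \<bar>c\<bar> * (LINT x|M. \<bar>f x - h x\<bar>)"
      by simp
    also have "\<dots> \<le> (\<bar>c\<bar> + 1) * (LINT x|M. \<bar>f x - h x\<bar>)"
      by (intro mult_right_mono) auto
    also have "\<dots> < e"
      using h(2) by (simp add: pos_less_divide_eq mult.commute)
    finally show ?thesis .
  qed
  ultimately show "\<exists>m h. level m h \<and> (LINT x|M. \<bar>c * f x - h x\<bar>) < e"
    by blast
qed

text \<open>Dominated convergence puts some \<open>s i\<close> within \<open>e / 2\<close> of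
  \<open>f\<close>, and a level function lies within \<open>e / 2\<close> of that
  \<open>s i\<close>. Complements, disjoint unions and general integrable functions are all reached
  through this closure property.\<close>

lemma approximable_lim:
  assumes s: "\<And>i. approximable (s i)" and f: "integrable M f" and w: "integrable M w"
    and lim: "\<And>x. x \<in> space M \<Longrightarrow> (\<lambda>i. s i x) \<longlonglongrightarrow> f x"
    and bound: "\<And>i x. x \<in> space M \<Longrightarrow> \<bar>s i x\<bar> \<le> w x"
  shows "approximable f"
  unfolding approximable_def
proof (intro conjI allI impI)
  show "integrable M f" by (rule f)
  fix e :: real assume "0 < e"
  have int_s: "integrable M (s i)" for i
    using s by (simp add: approximable_def)
  have [measurable]: "f \<in> borel_measurable M" "s i \<in> borel_measurable M" for i
    using f int_s by (auto intro: borel_measurable_integrable)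
  have "(\<lambda>i. LINT x|M. \<bar>f x - s i x\<bar>) \<longlonglongrightarrow> (LINT x|M. 0)"
  proof (rule integral_dominated_convergence[where w = "\<lambda>x. \<bar>f x\<bar> + w x"])
    show "AE x in M. (\<lambda>i. \<bar>f x - s i x\<bar>) \<longlonglongrightarrow> 0"
    proof (intro AE_I2)
      fix x assume "x \<in> space M"
      from tendsto_rabs[OF tendsto_diff[OF tendsto_const lim[OF this]], of "f x"]
      show "(\<lambda>i. \<bar>f x - s i x\<bar>) \<longlonglongrightarrow> 0" by simp
    qed
    show "AE x in M. norm \<bar>f x - s i x\<bar> \<le> \<bar>f x\<bar> + w x" for i
    proof (intro AE_I2)
      fix x assume "x \<in> space M"
      from bound[OF this, of i] show "norm \<bar>f x - s i x\<bar> \<le> \<bar>f x\<bar> + w x"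
        by auto
    qed
    show "integrable M (\<lambda>x. \<bar>f x\<bar> + w x)"
      using f w by simp
  qed simp_all
  then have "\<forall>\<^sub>F i in sequentially. (LINT x|M. \<bar>f x - s i x\<bar>) < e / 2"
    using \<open>0 < e\<close> by (intro order_tendstoD) auto
  then obtain i where i: "(LINT x|M. \<bar>f x - s i x\<bar>) < e / 2"
    using eventually_happens'[OF sequentially_bot] by blast
  obtain m h where h: "level m h" "(LINT x|M. \<bar>s i x - h x\<bar>) < e / 2"
    using s[of i] \<open>0 < e\<close> unfolding approximable_def by (meson half_gt_zero)
  have "(LINT x|M. \<bar>f x - h x\<bar>) \<le> (LINT x|M. \<bar>f x - s i x\<bar> + \<bar>s i x - h x\<bar>)"
    using f int_s[of i] level_integrable[OF h(1)] by (intro integral_mono) auto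
  also have "\<dots> = (LINT x|M. \<bar>f x - s i x\<bar>) + (LINT x|M. \<bar>s i x - h x\<bar>)"
    using f int_s[of i] level_integrable[OF h(1)]
    by (intro Bochner_Integration.integral_add) auto
  also have "\<dots> < e"
    using h i by simp
  finally show "\<exists>m h. level m h \<and> (LINT x|M. \<bar>f x - h x\<bar>) < e"
    using h(1) by blast
qed

lemma level_indicator_cell: "level m (indicator (cell m x) :: 'a \<Rightarrow> real)"
  by (simp add: level_def indicator_def cell_def)

text \<open>Dynkin's pi-lambda argument: the sets with approximable indicator contain the cells and
  are closed under complements and countable disjoint unions.\<close>

lemma approximable_indicator:
  assumes "A \<in> sets M"
  shows "approximable (indicator A)"
proof -
  \<comment> \<open>The empty set is added because disjoint cells must have their intersection in
    the family; cells that meet are nested.\<close>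
  let ?G = "insert {} {cell m x | m x. x \<in> space M}"
  have sub: "?G \<subseteq> sets M"
    by auto
  have sub_M: "sigma_sets (space M) ?G \<subseteq> sets M"
    by (rule sets.sigma_sets_subset[OF sub])
  have "{{y \<in> space M. label m y = label m x} | m x. x \<in> space M} \<subseteq> ?G"
    by (auto simp: cell_def)
  then have A: "A \<in> sigma_sets (space M) ?G"
    using assms generated sigma_sets_subseteq[of _ ?G] by (meson subset_iff)
  have "B \<inter> C \<in> ?G" if BC: "B \<in> ?G" "C \<in> ?G" for B C
  proof (cases "B \<inter> C = {}")
    case False
    then obtain z where z: "z \<in> B" "z \<in> C"
      by blast
    obtain m x where B: "B = cell m x"
      using BC(1) z(1) by blast
    obtain n y where C: "C = cell n y"
      using BC(2) z(2) by blast
    have zM: "z \<in> space M"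
      using z(1) B by (simp add: cell_def)
    have "B = cell m z" "C = cell n z"
      using z B C by (auto simp: cell_def)
    then have "B \<inter> C = cell m z \<or> B \<inter> C = cell n z"
      using cell_antimono[OF _ zM] by (metis inf.absorb1 inf.absorb2 nat_le_linear)
    then show ?thesis
      using zM by blast
  qed simp
  then have "Int_stable ?G"
    by (auto intro!: Int_stableI)
  moreover have "?G \<subseteq> Pow (space M)"
    by (auto simp: cell_def)
  ultimately show ?thesis
    using A
  proof (induction rule: sigma_sets_induct_disjoint)
    case (basic A)
    then consider "A = {}" | m x where "A = cell m x"
      by blast
    then show ?case
    proof cases
      case 1
      show ?thesis
        by (rule approximable_level[of 0]) (simp add: level_def 1)
    next
      case 2
      then show ?thesis
        using approximable_level[OF level_indicator_cell] by simp
    qed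
  next
    case empty
    show ?case
      by (rule approximable_level[of 0]) (simp add: level_def)
  next
    case (compl A)
    have "approximable (\<lambda>x. 1 + (-1) * indicator A x)"
      by (intro approximable_add approximable_scale compl.IH approximable_level[of 0])
         (simp add: level_def)
    moreover have "space M - A \<in> sets M"
      using compl.hyps sub_M by blast
    then have "integrable M (indicator (space M - A) :: 'a \<Rightarrow> real)"
      by (simp add: emeasure_eq_measure)
    \<comment> \<open>The limit lemma is applied to a constant sequence:
      \<open>1 - indicator A\<close> and the indicator of \<open>space M - A\<close> agree only on
      \<open>space M\<close>, which is where that lemma compares functions.\<close>
    ultimately show ?case
      by (rule approximable_lim[where w = "\<lambda>_. 1"]) (auto simp: indicator_def)
  next
    case (union A)
    then have AM: "A i \<in> sets M" for i
      using sub_M by blast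
    show ?case
    proof (rule approximable_lim[where s = "\<lambda>n x. \<Sum>i<n. indicator (A i) x" and w = "\<lambda>_. 1"])
      show "approximable (\<lambda>x. \<Sum>i<n. indicator (A i) x)" for n
      proof (induction n)
        case 0
        show ?case
          by (rule approximable_level[of 0]) (simp add: level_def)
      qed (simp add: approximable_add union.IH)
      \<comment> \<open>Disjointness turns the partial sum into an indicator, which yields both the
        majorant 1 and the pointwise limit.\<close>
      have eq: "(\<Sum>i<n. indicator (A i) x) = (indicator (\<Union>i<n. A i) x :: real)" for n x
        using union.hyps by (subst indicator_UN_disjoint) (auto simp: disjoint_family_on_def)
      show "\<bar>\<Sum>i<n. indicator (A i) x\<bar> \<le> (1 :: real)" for n x
        unfolding eq by (simp add: indicator_def)
      show "integrable M (indicator (\<Union>i. A i) :: 'a \<Rightarrow> real)"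
        using AM by (intro integrable_real_indicator) (auto simp: emeasure_eq_measure)
      show "(\<lambda>n. \<Sum>i<n. indicator (A i) x) \<longlonglongrightarrow> (indicator (\<Union>i. A i) x :: real)" for x
        unfolding eq by (rule LIMSEQ_indicator_UN)
    qed (use AM in auto)
  qed
qed

lemma integrable_approximable:
  assumes "integrable M f"
  shows "approximable f"
  using assms
proof (induction rule: integrable_induct)
  case (base A c)
  have "approximable (\<lambda>x. c * indicator A x)"
    by (intro approximable_scale approximable_indicator base(1))
  then show ?case
    by (simp only: real_scaleR_def mult.commute[of c])
next
  case (add f g)
  then show ?case by (simp add: approximable_add)
next
  case (lim f s)
  show ?case
  \<comment> \<open>The majorant \<open>2 * \<bar>f x\<bar>\<close> is the bound that
    \<open>integrable_induct\<close> provides for its approximating sequence.\<close>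
  proof (rule approximable_lim[where s = s and w = "\<lambda>x. 2 * \<bar>f x\<bar>"])
    show "integrable M (\<lambda>x. 2 * \<bar>f x\<bar>)"
      using lim by simp
  qed (use lim in simp_all)
qed

section \<open>Almost everywhere convergence of the cell averages\<close>

text \<open>Each generation has finitely many cells, so its null cells have a null union; there are
  countably many generations.\<close>

lemma AE_cell_pos: "AE x in M. \<forall>m. 0 < prob (cell m x)"
proof (subst AE_all_countable, intro allI)
  fix m
  let ?N = "{B \<in> cell m ` space M. prob B = 0}"
  have "\<Union>?N \<in> null_sets M"
  proof (rule null_sets_UN'[of ?N "\<lambda>B. B", simplified])
    show "countable ?N"
      using finite_cells by (simp add: countable_finite)
    show "B \<in> null_sets M" if "B \<in> cell m ` space M \<and> prob B = 0" for B
      using that by (auto simp: emeasure_eq_measure)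
  qed
  then show "AE x in M. 0 < prob (cell m x)"
  proof (rule AE_I')
    show "{x \<in> space M. \<not> 0 < prob (cell m x)} \<subseteq> \<Union>?N"
      using cell_self by (auto simp: zero_less_measure_iff)
  qed
qed

theorem AE_cell_average_tendsto:
  fixes f :: "'a \<Rightarrow> real"
  assumes f: "integrable M f"
  shows "AE x in M. (\<lambda>m. cell_average m f x) \<longlonglongrightarrow> f x"
proof -
  have [measurable]: "f \<in> borel_measurable M"
    using f by simp
  \<comment> \<open>The tolerance is \<open>2 * e\<close> because the error splits in two: the cell
    average of \<open>\<bar>f - h\<bar>\<close> and the value of \<open>\<bar>f - h\<bar>\<close> at
    the point, each allowed \<open>e\<close>.\<close>
  have AE_close: "AE x in M. \<not> (\<forall>N. \<exists>m\<ge>N. 2 * e < \<bar>cell_average m f x - f x\<bar>)" if e: "0 < e" for e :: real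
  proof -
    let ?bad = "{x \<in> space M. \<forall>N. \<exists>m\<ge>N. 2 * e < \<bar>cell_average m f x - f x\<bar>}"
    have [measurable]: "?bad \<in> sets M"
      by measurable
    have "prob ?bad \<le> 0 + d" if d: "0 < d" for d
    proof -
      \<comment> \<open>The maximal inequality and Markov's inequality each cost the integral of
        \<open>\<bar>f - h\<bar>\<close> divided by \<open>e\<close>, hence less than
        \<open>d / 2\<close>.\<close>
      have "0 < d * e / 2"
        using d e by simp
      then obtain n h where h: "level n h" "(LINT x|M. \<bar>f x - h x\<bar>) < d * e / 2"
        using integrable_approximable[OF f] unfolding approximable_def by meson
      have int_h: "integrable M h"
        using h(1) by (rule level_integrable)
      then have [measurable]: "h \<in> borel_measurable M"
        by simp
      let ?g = "\<lambda>x. \<bar>f x - h x\<bar>"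
      let ?A = "{x \<in> space M. \<exists>m. e < cell_average m ?g x}"
      let ?B = "{x \<in> space M. e \<le> ?g x}"
      have int_g: "integrable M ?g"
        using f int_h by simp
      have "AE x in M. x \<in> ?bad \<longrightarrow> x \<in> ?A \<union> ?B"
        using AE_cell_pos
      proof eventually_elim
        case (elim x)
        show ?case
        proof (rule impI, rule ccontr)
          assume x: "x \<in> ?bad" "x \<notin> ?A \<union> ?B"
          \<comment> \<open>From generation \<open>n\<close> on, \<open>h\<close> is constant on the
            cell of \<open>x\<close>, so its average there is exactly \<open>h x\<close>.\<close>
          then obtain m where m: "n \<le> m" "2 * e < \<bar>cell_average m f x - f x\<bar>"
            by blast
          have xM: "x \<in> space M"
            using x by simp
          have C: "cell m x \<in> sets M"
            using xM by simp
          have pos: "0 < prob (cell m x)"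
            using elim by simp
          have si: "set_integrable M (cell m x) f" "set_integrable M (cell m x) h"
            using set_integrable_of_integrable f int_h C by auto
          have h_eq: "h y = h x" if "y \<in> cell m x" for y
          proof -
            have "y \<in> space M" "label m y = label m x"
              using that by (auto simp: cell_def)
            then show ?thesis
              using levelD[OF level_mono[OF h(1) m(1)]] xM by blast
          qed
          have "(LINT y:cell m x|M. h y) = (LINT y:cell m x|M. h x)"
            using C h_eq by (intro set_lebesgue_integral_cong) auto
          also have "\<dots> = h x * prob (cell m x)"
            using C by (simp add: set_lebesgue_integral_def)
          finally have "cell_average m f x - h x =
              (LINT y:cell m x|M. f y - h y) / prob (cell m x)"
            using pos si by (simp add: cell_average_def set_integral_diff field_simps)
          moreover have "\<bar>LINT y:cell m x|M. f y - h y\<bar> \<le> (LINT y:cell m x|M. ?g y)"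
            using set_integral_norm_bound[of M "cell m x" "\<lambda>y. f y - h y"] si
            by (auto simp: set_integral_diff)
          ultimately have "\<bar>cell_average m f x - h x\<bar> \<le> cell_average m ?g x"
            using pos by (simp add: cell_average_def divide_right_mono)
          moreover have "cell_average m ?g x \<le> e" "?g x < e"
            using x(2) xM by (simp_all only: Un_iff mem_Collect_eq) (auto simp: not_less)
          ultimately show False
            using m(2) by linarith
        qed
      qed
      then have "prob ?bad \<le> prob (?A \<union> ?B)"
        by (intro finite_measure_mono_AE) measurable
      also have "\<dots> \<le> prob ?A + prob ?B"
        by (intro measure_Un_le) measurable
      also have "prob ?A \<le> (LINT x|M. ?g x) / e"
        using maximal_inequality[OF int_g, of e] e by (simp add: pos_le_divide_eq mult.commute)
      also have "prob ?B \<le> (LINT x|M. ?g x) / e"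
        using int_g e by (intro integral_Markov_inequality_measure) auto
      also have "(LINT x|M. ?g x) / e + (LINT x|M. ?g x) / e \<le> 0 + d"
        using h(2) e by (simp add: field_simps)
      finally show ?thesis by simp
    qed
    then have "prob ?bad \<le> 0"
      by (rule field_le_epsilon)
    then have "prob ?bad = 0"
      using measure_nonneg[of M ?bad] by linarith
    then have "?bad \<in> null_sets M"
      by (simp add: emeasure_eq_measure null_setsI)
    then show ?thesis
      by (rule AE_I') auto
  qed
  have "AE x in M. \<forall>k. \<not> (\<forall>N. \<exists>m\<ge>N. 2 * (1 / Suc k) < \<bar>cell_average m f x - f x\<bar>)"
    unfolding AE_all_countable
  proof
    show "AE x in M. \<not> (\<forall>N. \<exists>m\<ge>N. 2 * (1 / Suc k) < \<bar>cell_average m f x - f x\<bar>)" for k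
      by (rule AE_close) simp
  qed
  then show ?thesis
  proof eventually_elim
    case (elim x)
    show ?case
    proof (rule LIMSEQ_I)
      fix r :: real assume "0 < r"
      then obtain k where "1 / Suc k < r / 2"
        using nat_approx_posE[of "r / 2"] by auto
      then have k: "2 * (1 / Suc k) < r"
        by simp
      from elim obtain N where "\<forall>m\<ge>N. \<bar>cell_average m f x - f x\<bar> \<le> 2 * (1 / Suc k)"
        by (auto simp: not_less)
      then show "\<exists>N. \<forall>m\<ge>N. norm (cell_average m f x - f x) < r"
        using k by (intro exI[of _ N]) (auto intro: le_less_trans)
    qed
  qed
qed

end

section \<open>Coordinates and diameters on the torus\<close>

text \<open>\<open>rep_circle\<close> returns an unspecified representative; the fractional part
  normalises it to the one in [0,1).\<close>

definition coord :: "circle \<Rightarrow> real"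
  where "coord c = frac (rep_circle c)"

lemma circle_of_eq_iff: "circle_of a = circle_of b \<longleftrightarrow> a - b \<in> \<int>"
  by (rule circle.abs_eq_iff)

lemma circle_of_diff: "circle_of a - circle_of b = circle_of (a - b)"
  by (rule minus_circle.abs_eq)

lemma circle_of_coord [simp]: "circle_of (coord c) = c"
proof -
  have "circle_of (coord c) = circle_of (rep_circle c)"
    by (simp add: circle_of_eq_iff coord_def frac_def)
  then show ?thesis
    using Quotient_abs_rep[OF Quotient_circle] by simp
qed

lemma coord_ge_0: "0 \<le> coord c" and coord_lt_1: "coord c < 1"
  by (simp_all add: coord_def frac_ge_0 frac_lt_1)

lemma coord_circle_of: "coord (circle_of r) = frac r"
proof -
  have "r - coord (circle_of r) \<in> \<int>"
    using circle_of_coord[of "circle_of r"] circle_of_eq_iff by metis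
  then show ?thesis
    using coord_ge_0 coord_lt_1 frac_unique_iff by metis
qed

text \<open>The preimage under \<open>circle_of\<close> is the union of the integer translates of
  (a,b). The bounds on \<open>a\<close> and \<open>b\<close> keep each translate within one period,
  away from the jump of \<open>coord\<close> at 0.\<close>

lemma open_coord_interval:
  assumes "0 \<le> a" "b \<le> 1"
  shows "open {c. a < coord c \<and> coord c < b}"
proof -
  have "circle_of -` {c. a < coord c \<and> coord c < b} = (\<Union>n::int. {of_int n + a<..<of_int n + b})"
  proof (intro equalityI subsetI)
    fix r :: real assume "r \<in> circle_of -` {c. a < coord c \<and> coord c < b}"
    then have "r \<in> {of_int \<lfloor>r\<rfloor> + a<..<of_int \<lfloor>r\<rfloor> + b}"
      by (simp add: coord_circle_of frac_def algebra_simps)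
    then show "r \<in> (\<Union>n::int. {of_int n + a<..<of_int n + b})"
      by blast
  next
    fix r assume "r \<in> (\<Union>n::int. {of_int n + a<..<of_int n + b})"
    then obtain n :: int where n: "of_int n + a < r" "r < of_int n + b"
      by auto
    then have "\<lfloor>r\<rfloor> = n"
      using assms by (intro floor_unique) auto
    then show "r \<in> circle_of -` {c. a < coord c \<and> coord c < b}"
      using n by (simp add: coord_circle_of frac_def)
  qed
  then show ?thesis
    by (simp add: open_circle_def open_UN)
qed

text \<open>Although \<open>coord\<close> jumps at 0, its strict superlevel sets are either
  everything or open arcs.\<close>

lemma coord_measurable [measurable]: "coord \<in> borel_measurable borel"
proof (rule borel_measurable_iff_greater[THEN iffD2], intro allI)
  fix a :: real
  show "{c \<in> space borel. a < coord c} \<in> sets borel"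
  proof (cases "a < 0")
    case True
    then have "{c \<in> space borel. a < coord c} = UNIV"
      using coord_ge_0 by (auto intro: less_le_trans)
    then show ?thesis by simp
  next
    case False
    then show ?thesis
      using open_coord_interval[of a 1] coord_lt_1 by simp
  qed
qed

text \<open>As \<open>a < k\<close> gives \<open>(a + 1) / k \<le> 1\<close>, the translated arc
  does not wrap around past 0, and ordinary inequalities between reals describe it.\<close>

lemma coord_translate_iff:
  assumes "0 < k" "a < k"
  shows "c - circle_of (real a / real k) \<in> circle_of ` {0<..<1 / real k} \<longleftrightarrow>
    real a < real k * coord c \<and> real k * coord c < real a + 1"
proof
  assume "c - circle_of (real a / real k) \<in> circle_of ` {0<..<1 / real k}"
  then obtain r where r: "0 < r" "r < 1 / real k" "c - circle_of (real a / real k) = circle_of r"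
    by auto
  then have "circle_of (coord c) - circle_of (real a / real k) = circle_of r"
    by simp
  then have "circle_of (coord c) = circle_of (r + real a / real k)"
    unfolding circle_of_diff circle_of_eq_iff by (simp add: algebra_simps)
  then have "coord c = frac (r + real a / real k)"
    by (metis circle_of_coord coord_circle_of)
  moreover have "r + real a / real k < (real a + 1) / real k"
    using r by (simp add: add_divide_distrib)
  moreover have "(real a + 1) / real k \<le> 1"
    using assms by (simp add: field_simps)
  ultimately have "coord c = r + real a / real k"
    using r(1) by (subst (asm) frac_eq[THEN iffD2]) auto
  then have "real k * coord c = real k * r + real a"
    using assms by (simp add: field_simps)
  moreover have "0 < real k * r" "real k * r < 1"
    using r assms by (auto simp: field_simps)
  ultimately show "real a < real k * coord c \<and> real k * coord c < real a + 1"
    by simp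
next
  assume "real a < real k * coord c \<and> real k * coord c < real a + 1"
  then have "0 < real k * (coord c - real a / real k)" "real k * (coord c - real a / real k) < 1"
    using assms by (simp_all add: right_diff_distrib)
  then have "coord c - real a / real k \<in> {0<..<1 / real k}"
    using assms by (simp add: zero_less_mult_iff pos_less_divide_eq mult.commute)
  moreover have "c - circle_of (real a / real k) = circle_of (coord c - real a / real k)"
    by (simp flip: circle_of_diff)
  ultimately show "c - circle_of (real a / real k) \<in> circle_of ` {0<..<1 / real k}"
    by blast
qed

text \<open>The dyadic rationals are countable and Lebesgue measure has no atoms.\<close>

lemma AE_circle_not_dyadic: "AE c in circle_measure. \<forall>k n. 2 ^ k * coord c \<noteq> of_int n"
  unfolding circle_measure_def
proof (subst AE_distr_iff)
  show "circle_of \<in> restrict_space lborel {0..<1} \<rightarrow>\<^sub>M borel"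
    by (rule measurable_restrict_space1) simp
  show "{c \<in> space borel. \<forall>k n. 2 ^ k * coord c \<noteq> of_int n} \<in> sets borel"
    by measurable
  have "AE r in lborel. \<forall>k n. r \<noteq> of_int n / 2 ^ k"
    by (simp add: AE_all_countable AE_lborel_singleton)
  then have "AE r in lborel. r \<in> {0..<1} \<longrightarrow> (\<forall>k n. 2 ^ k * coord (circle_of r) \<noteq> of_int n)"
  proof eventually_elim
    case (elim r)
    then show ?case
      by (auto simp: coord_circle_of frac_eq[THEN iffD2] field_simps)
  qed
  then show "AE r in restrict_space lborel {0..<1}. \<forall>k n. 2 ^ k * coord (circle_of r) \<noteq> of_int n"
    by (subst AE_restrict_space_iff) auto
qed

section \<open>The metric and the diameter\<close>

lemma circle_norm_nonneg: "0 \<le> circle_norm c"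
  unfolding circle_norm_def
  by (rule cINF_greatest) (use circle_of_coord in \<open>blast, simp\<close>)

lemma circle_norm_le: "circle_norm (circle_of r) \<le> \<bar>r\<bar>"
  unfolding circle_norm_def
  by (rule cINF_lower) (auto intro!: bdd_belowI[of _ 0])

lemma circle_norm_diff_le: "circle_norm (c - d) \<le> \<bar>coord c - coord d\<bar>"
  using circle_norm_le[of "coord c - coord d"] by (simp flip: circle_of_diff)

lemma abs_coord_diff_le: "\<bar>coord c - coord d\<bar> \<le> 1"
  using coord_ge_0[of c] coord_lt_1[of c] coord_ge_0[of d] coord_lt_1[of d] by linarith

text \<open>The representatives of 1/2 are the half-integers. The bound serves to show that
  diameters are positive.\<close>

lemma circle_norm_half: "1 / 2 \<le> circle_norm (circle_of (1 / 2))"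
  unfolding circle_norm_def
proof (rule cINF_greatest)
  fix r assume "r \<in> {r. circle_of r = circle_of (1 / 2)}"
  then obtain n :: int where n: "r = of_int n + 1 / 2"
    by (auto simp: circle_of_eq_iff elim!: Ints_cases) (metis diff_add_cancel)
  have "n \<le> -1 \<or> 0 \<le> n" by linarith
  then show "1 / 2 \<le> \<bar>r\<bar>"
  proof
    assume "n \<le> -1"
    then have "real_of_int n \<le> -1" by simp
    then show ?thesis using n by linarith
  next
    assume "0 \<le> n"
    then have "0 \<le> real_of_int n" by simp
    then show ?thesis using n by linarith
  qed
qed auto

lemma summable_half_powers: "summable (\<lambda>i. 1 / 2 ^ Suc i :: real)"
  using sums_summable[OF power_half_series] by (simp add: power_one_over)

lemma torus_dist_terms:
  "0 \<le> circle_norm (x i - y i) / 2 ^ Suc i" "circle_norm (x i - y i) / 2 ^ Suc i \<le> 1 / 2 ^ Suc i"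
proof -
  show "0 \<le> circle_norm (x i - y i) / 2 ^ Suc i"
    by (simp add: circle_norm_nonneg)
  have "circle_norm (x i - y i) \<le> 1"
    using circle_norm_diff_le abs_coord_diff_le by (rule order_trans)
  then show "circle_norm (x i - y i) / 2 ^ Suc i \<le> 1 / 2 ^ Suc i"
    by (rule divide_right_mono) simp
qed

lemma summable_torus_dist: "summable (\<lambda>i. circle_norm (x i - y i) / 2 ^ Suc i)"
proof (rule summable_comparison_test'[OF summable_half_powers])
  show "norm (circle_norm (x i - y i) / 2 ^ Suc i) \<le> 1 / 2 ^ Suc i" for i
    using torus_dist_terms[of x i y] by (simp only: real_norm_def abs_of_nonneg)
qed

text \<open>A real \<open>SUP\<close> is a genuine supremum only over a bounded set; the summable
  weights bound all distances at once.\<close>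

lemma bdd_above_torus_dist: "bdd_above ((\<lambda>(x, y). torus_dist x y) ` (S \<times> S))"
proof (rule bdd_aboveI)
  fix d assume "d \<in> (\<lambda>(x, y). torus_dist x y) ` (S \<times> S)"
  then obtain x y where "d = torus_dist x y" by auto
  then show "d \<le> (\<Sum>i. 1 / 2 ^ Suc i)"
    unfolding torus_dist_def
    by (auto intro!: suminf_le torus_dist_terms summable_torus_dist summable_half_powers
        simp del: power_Suc)
qed

lemma torus_dist_le_diameter: "x \<in> S \<Longrightarrow> y \<in> S \<Longrightarrow> torus_dist x y \<le> torus_diameter S"
  unfolding torus_diameter_def
  using cSUP_upper[OF _ bdd_above_torus_dist, of "(x, y)" S] by simp

lemma torus_diameter_le:
  assumes "x \<in> S" "\<And>x y. x \<in> S \<Longrightarrow> y \<in> S \<Longrightarrow> torus_dist x y \<le> b"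
  shows "torus_diameter S \<le> b"
  unfolding torus_diameter_def by (rule cSUP_least) (use assms in auto)

lemma torus_diameter_pos:
  assumes "x \<in> S" "y \<in> S" "x i - y i = circle_of (1 / 2)"
  shows "0 < torus_diameter S"
proof -
  have "0 < circle_norm (x i - y i) / 2 ^ Suc i"
    using circle_norm_half assms(3) by simp
  also have "\<dots> \<le> torus_dist x y"
    unfolding torus_dist_def
    using sum_le_suminf[OF summable_torus_dist, of "{i}" x y] torus_dist_terms(1)[of x _ y] by simp
  also have "\<dots> \<le> torus_diameter S"
    using assms by (intro torus_dist_le_diameter)
  finally show ?thesis .
qed

section \<open>Side lengths of the boxes\<close>

text \<open>
  The side of the \<open>m\<close>-th box in direction \<open>i\<close> (counted from 0) is \<open>1 / 2 ^ level_exponent m i\<close>,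
  also for \<open>m = 1\<close>. The junk generation \<open>m = 0\<close> gives the trivial partition.
\<close>

definition level_exponent :: "nat \<Rightarrow> nat \<Rightarrow> nat"
  where "level_exponent m i =
    (let n = floor_sqrt (m - 1); j = m - n\<^sup>2 in
     if j \<le> n then (if i < n then n else if i = n then j else 0)
     else (if i < j - n then n + 1 else if i \<le> n then n else 0))"

text \<open>Here \<open>n = 0\<close> is allowed; it covers exactly \<open>m = 1\<close>, so the
  first generation follows the general formula.\<close>

lemma square_add_cases:
  fixes m :: nat
  assumes "1 \<le> m"
  obtains n j where "m = n\<^sup>2 + j" "1 \<le> j" "j \<le> 2 * n + 1"
proof
  let ?n = "floor_sqrt (m - 1)"
  have "?n\<^sup>2 \<le> m - 1" "m - 1 < (Suc ?n)\<^sup>2"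
    by (simp_all add: Suc_floor_sqrt_power2_gt)
  moreover have "(Suc ?n)\<^sup>2 = ?n\<^sup>2 + 2 * ?n + 1"
    by (simp add: power2_eq_square)
  ultimately show "m = ?n\<^sup>2 + (m - ?n\<^sup>2)" "1 \<le> m - ?n\<^sup>2" "m - ?n\<^sup>2 \<le> 2 * ?n + 1"
    using assms by linarith+
qed

lemma floor_sqrt_square_add:
  assumes "1 \<le> j" "j \<le> 2 * n + 1"
  shows "floor_sqrt (n\<^sup>2 + j - 1) = n"
  by (rule floor_sqrt_unique) (use assms in \<open>auto simp: power2_eq_square\<close>)

lemma level_exponent_square_add:
  assumes "1 \<le> j" "j \<le> 2 * n + 1"
  shows "level_exponent (n\<^sup>2 + j) i =
    (if j \<le> n then (if i < n then n else if i = n then j else 0)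
     else (if i < j - n then n + 1 else if i \<le> n then n else 0))"
  using floor_sqrt_square_add[OF assms] by (simp add: level_exponent_def)

lemma level_exponent_0: "level_exponent 0 i = 0"
  by (simp add: level_exponent_def)

lemma denominators_square_add':
  assumes "1 \<le> j" "j \<le> 2 * n + 1"
  shows "length (denominators (n\<^sup>2 + j)) = Suc n"
    and "i \<le> n \<Longrightarrow> denominators (n\<^sup>2 + j) ! i = 2 ^ level_exponent (n\<^sup>2 + j) i"
proof -
  have "length (denominators (n\<^sup>2 + j)) = Suc n \<and>
    (i \<le> n \<longrightarrow> denominators (n\<^sup>2 + j) ! i = 2 ^ level_exponent (n\<^sup>2 + j) i)"
  proof (cases "n = 0")
    case True
    then have "j = 1"
      using assms by simp
    have "level_exponent 1 0 = 1"
      using level_exponent_square_add[of 1 0 0] by simp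
    then show ?thesis
      by (simp add: \<open>j = 1\<close> True denominators_def)
  next
    case False
    then show ?thesis
      using assms unfolding level_exponent_square_add[OF assms]
      by (subst (1 2) denominators_square_add) (auto simp: nth_append)
  qed
  then show "length (denominators (n\<^sup>2 + j)) = Suc n"
    "i \<le> n \<Longrightarrow> denominators (n\<^sup>2 + j) ! i = 2 ^ level_exponent (n\<^sup>2 + j) i"
    by auto
qed

lemma level_exponent_eq_0:
  assumes "1 \<le> m" "length (denominators m) \<le> i"
  shows "level_exponent m i = 0"
proof -
  obtain n j where m: "m = n\<^sup>2 + j" and j: "1 \<le> j" "j \<le> 2 * n + 1"
    using square_add_cases[OF assms(1)] .
  then show ?thesis
    using assms(2) denominators_square_add'(1)[OF j]
    by (auto simp: m level_exponent_square_add[OF j])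
qed

lemma nth_denominators:
  assumes "1 \<le> m" "i < length (denominators m)"
  shows "denominators m ! i = 2 ^ level_exponent m i"
proof -
  obtain n j where m: "m = n\<^sup>2 + j" and j: "1 \<le> j" "j \<le> 2 * n + 1"
    using square_add_cases[OF assms(1)] .
  then show ?thesis
    using assms(2) denominators_square_add'[OF j] by simp
qed

text \<open>Within a block \<open>n\<close> the step from \<open>j\<close> to \<open>j + 1\<close>
  raises one exponent. At the end of the block, \<open>j = 2 * n + 1\<close>, all coordinates up to
  \<open>n\<close> have exponent \<open>n + 1\<close>; the next block starts with these and cuts
  coordinate \<open>n + 1\<close> for the first time.\<close>

lemma level_exponent_mono: "level_exponent m i \<le> level_exponent (Suc m) i"
proof (cases "m = 0")
  case True
  then show ?thesis by (simp add: level_exponent_0)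
next
  case False
  then obtain n j where m: "m = n\<^sup>2 + j" and j: "1 \<le> j" "j \<le> 2 * n + 1"
    using square_add_cases[of m] by auto
  show ?thesis
  proof (cases "j = 2 * n + 1")
    case True
    then have eq: "Suc m = (n + 1)\<^sup>2 + 1"
      by (simp add: m power2_eq_square)
    show ?thesis
      unfolding eq unfolding m level_exponent_square_add[OF j]
      by (subst level_exponent_square_add) (use True in auto)
  next
    case False
    then have eq: "Suc m = n\<^sup>2 + (j + 1)"
      by (simp add: m)
    show ?thesis
      unfolding eq unfolding m level_exponent_square_add[OF j]
      by (subst level_exponent_square_add) (use False j in auto)
  qed
qed

text \<open>In block \<open>n\<close> every coordinate below \<open>n\<close> has exponent at least
  \<open>n\<close>. The threshold brings the block number to at least \<open>N\<close> and beyond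
  \<open>i\<close>.\<close>

lemma filterlim_level_exponent: "filterlim (\<lambda>m. level_exponent m i) at_top sequentially"
  unfolding filterlim_at_top
proof
  fix N
  have "N \<le> level_exponent m i" if m: "(max N (Suc i))\<^sup>2 + 1 \<le> m" for m
  proof -
    have "1 \<le> m"
      using m by simp
    then obtain n j where eq: "m = n\<^sup>2 + j" and j: "1 \<le> j" "j \<le> 2 * n + 1"
      using square_add_cases by blast
    have "max N (Suc i) = floor_sqrt ((max N (Suc i))\<^sup>2)"
      by simp
    also have "\<dots> \<le> floor_sqrt (m - 1)"
      using m by (intro mono_floor_sqrt') simp
    also have "\<dots> = n"
      using floor_sqrt_square_add[OF j] by (simp add: eq)
    finally show ?thesis
      by (auto simp: eq level_exponent_square_add[OF j])
  qed
  then show "\<forall>\<^sub>F m in sequentially. N \<le> level_exponent m i"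
    unfolding eventually_sequentially by blast
qed

lemma inverse_power_level_exponent: "(\<lambda>m. 1 / 2 ^ level_exponent m i :: real) \<longlonglongrightarrow> 0"
proof -
  have "(\<lambda>k. (1 / 2 :: real) ^ k) \<longlonglongrightarrow> 0"
    by (rule LIMSEQ_realpow_zero) auto
  from filterlim_compose[OF this filterlim_level_exponent, of i]
  show ?thesis by (simp add: power_one_over)
qed

section \<open>The basis of dyadic cells\<close>

lemma space_haar [simp]: "space haar = UNIV"
  by (simp add: haar_def circle_measure_def space_PiM)

lemma sets_circle_measure [measurable_cong]: "sets circle_measure = sets borel"
  by (simp add: circle_measure_def)

lemma component_measurable [measurable]: "(\<lambda>x. x i) \<in> haar \<rightarrow>\<^sub>M borel"
proof -
  have "(\<lambda>x. x i) \<in> haar \<rightarrow>\<^sub>M circle_measure"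
    unfolding haar_def by measurable
  then show ?thesis
    by (simp cong: measurable_cong_sets add: sets_circle_measure)
qed

text \<open>Entry \<open>i\<close> names the half-open dyadic interval containing the coordinate; it
  is 0 for coordinates not yet cut.\<close>

definition dyadic_label :: "nat \<Rightarrow> torus \<Rightarrow> nat \<Rightarrow> int"
  where "dyadic_label m x i = \<lfloor>2 ^ level_exponent m i * coord (x i)\<rfloor>"

lemma dyadic_label_measurable [measurable]:
  "(\<lambda>x. dyadic_label m x i) \<in> haar \<rightarrow>\<^sub>M count_space UNIV"
  unfolding dyadic_label_def by measurable

lemma dyadic_label_bounds: "0 \<le> dyadic_label m x i" "dyadic_label m x i < 2 ^ level_exponent m i"
proof -
  have "0 \<le> 2 ^ level_exponent m i * coord (x i)"
    by (simp add: coord_ge_0)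
  then show "0 \<le> dyadic_label m x i"
    by (simp add: dyadic_label_def)
  have "2 ^ level_exponent m i * coord (x i) < 2 ^ level_exponent m i"
    using coord_lt_1 by simp
  then show "dyadic_label m x i < 2 ^ level_exponent m i"
    by (simp add: dyadic_label_def floor_less_iff)
qed

lemma dyadic_label_eq_0: "level_exponent m i = 0 \<Longrightarrow> dyadic_label m x i = 0"
  using dyadic_label_bounds[of m x i] by simp

lemma finite_dyadic_labels: "finite (range (dyadic_label m))"
proof (cases "m = 0")
  case True
  then have "range (dyadic_label m) \<subseteq> {\<lambda>_. 0}"
    by (auto simp: dyadic_label_eq_0 level_exponent_0)
  then show ?thesis
    by (rule finite_subset) simp
next
  case False
  let ?A = "{..<length (denominators m)}"
  let ?B = "\<Union>i\<in>?A. {0..<2 ^ level_exponent m i :: int}"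
  let ?F = "{f. \<forall>i. (i \<in> ?A \<longrightarrow> f i \<in> ?B) \<and> (i \<notin> ?A \<longrightarrow> f i = 0)}"
  have "dyadic_label m x \<in> ?F" for x
    using False dyadic_label_bounds[of m x] by (auto intro!: dyadic_label_eq_0 level_exponent_eq_0)
  then have "range (dyadic_label m) \<subseteq> ?F"
    by blast
  moreover have "finite ?F"
    by (rule finite_set_of_finite_funs) auto
  ultimately show ?thesis
    by (rule finite_subset)
qed

text \<open>The integer part of \<open>2 ^ k * c\<close> is that of \<open>2 ^ (k + d) * c\<close>
  divided by \<open>2 ^ d\<close> as integers, so the coarser label is a function of the finer
  one.\<close>

lemma dyadic_label_refine:
  assumes "dyadic_label (Suc m) x = dyadic_label (Suc m) y"
  shows "dyadic_label m x = dyadic_label m y"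
proof
  fix i
  let ?d = "level_exponent (Suc m) i - level_exponent m i"
  have "dyadic_label m z i = dyadic_label (Suc m) z i div 2 ^ ?d" for z
  proof -
    have "(2::real) ^ level_exponent (Suc m) i = 2 ^ level_exponent m i * 2 ^ ?d"
      using level_exponent_mono[of m i] by (simp flip: power_add)
    then have "2 ^ level_exponent m i * coord (z i) =
        2 ^ level_exponent (Suc m) i * coord (z i) / of_int (2 ^ ?d)"
      by simp
    then show ?thesis
      unfolding dyadic_label_def by (simp only: floor_divide_real_eq_div zero_le_power zero_le_numeral)
  qed
  then show "dyadic_label m x i = dyadic_label m y i"
    using assms by simp
qed

lemma dyadic_label_tendsto:
  "(\<lambda>m. of_int (dyadic_label m x i) / 2 ^ level_exponent m i) \<longlonglongrightarrow> coord (x i)"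
proof -
  have "(\<lambda>m. of_int (dyadic_label m x i) / 2 ^ level_exponent m i - coord (x i)) \<longlonglongrightarrow> 0"
  proof (rule Lim_null_comparison[OF _ inverse_power_level_exponent[of i]], intro always_eventually allI)
    fix m
    let ?k = "2 ^ level_exponent m i :: real"
    have "of_int (dyadic_label m x i) / ?k - coord (x i) =
        (of_int (dyadic_label m x i) - ?k * coord (x i)) / ?k"
      by (simp add: diff_divide_distrib)
    moreover have "\<bar>of_int (dyadic_label m x i) - ?k * coord (x i)\<bar> \<le> 1"
      unfolding dyadic_label_def by linarith
    ultimately show "norm (of_int (dyadic_label m x i) / ?k - coord (x i)) \<le> 1 / ?k"
      by (simp add: divide_right_mono)
  qed
  then show ?thesis
    by (simp add: LIM_zero_iff)
qed

text \<open>Each coordinate is a limit of functions of the labels, hence measurable for the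
  sigma-algebra that the cells generate.\<close>

lemma sets_haar_generated:
  "sets haar \<subseteq> sigma_sets UNIV {{y. dyadic_label m y = dyadic_label m x} | m x. True}"
proof -
  let ?G = "{{y. dyadic_label m y = dyadic_label m x} | m x. True}"
  let ?F = "sigma UNIV ?G"
  have lbl: "(\<lambda>x. dyadic_label m x i) \<in> ?F \<rightarrow>\<^sub>M count_space UNIV" for m i
  proof (rule measurableI)
    fix S :: "int set"
    let ?cell = "\<lambda>x. {y. dyadic_label m y = dyadic_label m x}"
    let ?C = "?cell ` {x. dyadic_label m x i \<in> S}"
    have "(\<lambda>x. dyadic_label m x i) -` S \<inter> space ?F = \<Union>?C"
      by auto
    moreover have "\<Union>?C \<in> sets ?F"
    proof (rule sets.finite_Union)
      have "?C \<subseteq> (\<lambda>b. {y. dyadic_label m y = b}) ` range (dyadic_label m)"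
        by auto
      then show "finite ?C"
        using finite_dyadic_labels by (meson finite_imageI finite_subset)
      show "?C \<subseteq> sets ?F"
        by auto
    qed
    ultimately show "(\<lambda>x. dyadic_label m x i) -` S \<inter> space ?F \<in> sets ?F"
      by simp
  qed simp
  have real: "(\<lambda>x. of_int (dyadic_label m x i) / 2 ^ level_exponent m i) \<in> borel_measurable ?F" for m i
    using lbl[of m i] by measurable
  have crd: "(\<lambda>x. coord (x i)) \<in> borel_measurable ?F" for i
    by (rule borel_measurable_LIMSEQ_real[OF dyadic_label_tendsto real])
  have comp: "(\<lambda>x. x i) \<in> ?F \<rightarrow>\<^sub>M circle_measure" for i
    using measurable_compose[OF crd measurable_circle_of]
    by (simp cong: measurable_cong_sets add: sets_circle_measure)
  \<comment> \<open>Measurability of the identity map is precisely the inclusion of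
    sigma-algebras.\<close>
  have "(\<lambda>x. x) \<in> ?F \<rightarrow>\<^sub>M haar"
    unfolding haar_def
    by (rule measurable_PiM_single') (use comp in \<open>auto simp: circle_measure_def\<close>)
  show ?thesis
  proof
    fix A assume "A \<in> sets haar"
    with \<open>(\<lambda>x. x) \<in> ?F \<rightarrow>\<^sub>M haar\<close> have "(\<lambda>x. x) -` A \<inter> space ?F \<in> sets ?F"
      by (rule measurable_sets)
    then show "A \<in> sigma_sets UNIV ?G"
      by simp
  qed
qed

interpretation torus: refining_labels haar dyadic_label
proof (intro refining_labels.intro refining_labels_axioms.intro prob_space_haar)
  show "{y \<in> space haar. dyadic_label m y = dyadic_label m x} \<in> sets haar" for m x
    unfolding fun_eq_iff by measurable
  show "finite (dyadic_label m ` space haar)" for m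
    using finite_dyadic_labels by simp
  show "dyadic_label m x = dyadic_label m y"
    if "dyadic_label (Suc m) x = dyadic_label (Suc m) y" for m x y
    using that by (rule dyadic_label_refine)
  show "sets haar \<subseteq> sigma_sets (space haar)
      {{y \<in> space haar. dyadic_label m y = dyadic_label m x} |m x. x \<in> space haar}"
    using sets_haar_generated by simp
qed

section \<open>Open cells and the basis at nondyadic points\<close>

definition nondyadic :: "torus \<Rightarrow> bool"
  where "nondyadic x \<longleftrightarrow> (\<forall>i k n. 2 ^ k * coord (x i) \<noteq> of_int n)"

lemma AE_nondyadic: "AE x in haar. nondyadic x"
  unfolding nondyadic_def haar_def AE_all_countable
  by (intro allI AE_PiM_component[OF prob_space_circle_measure] UNIV_I)
     (use AE_circle_not_dyadic in \<open>auto elim: eventually_mono\<close>)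

text \<open>The index is a whole integer sequence so that \<open>dyadic_label m x\<close> can serve
  as one directly.\<close>

definition open_cell :: "nat \<Rightarrow> (nat \<Rightarrow> int) \<Rightarrow> torus set"
  where "open_cell m a = {y. \<forall>i<length (denominators m).
    of_int (a i) < 2 ^ level_exponent m i * coord (y i) \<and>
    2 ^ level_exponent m i * coord (y i) < of_int (a i) + 1}"

lemma open_cell_measurable [measurable]: "open_cell m a \<in> sets haar"
proof -
  have "open_cell m a = {y \<in> space haar. \<forall>i<length (denominators m).
    of_int (a i) < 2 ^ level_exponent m i * coord (y i) \<and>
    2 ^ level_exponent m i * coord (y i) < of_int (a i) + 1}"
    by (simp add: open_cell_def)
  also have "\<dots> \<in> sets haar"
    by measurable
  finally show ?thesis .
qed

text \<open>A scaled coordinate of \<open>y\<close> is never an integer, so the inequalities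
  defining its integer part are strict on both sides. The point \<open>x\<close> only supplies the
  index and may be dyadic.\<close>

lemma nondyadic_mem_open_cell_iff:
  assumes "1 \<le> m" "nondyadic y"
  shows "y \<in> open_cell m (dyadic_label m x) \<longleftrightarrow> dyadic_label m y = dyadic_label m x"
proof -
  have *: "of_int a < 2 ^ level_exponent m i * coord (y i) \<and>
      2 ^ level_exponent m i * coord (y i) < of_int a + 1 \<longleftrightarrow> dyadic_label m y i = a" for a i
  proof -
    have "2 ^ level_exponent m i * coord (y i) \<noteq> of_int a"
      using assms(2) by (simp add: nondyadic_def)
    then show ?thesis
      unfolding dyadic_label_def floor_eq_iff by linarith
  qed
  have "dyadic_label m y i = dyadic_label m x i" if "length (denominators m) \<le> i" for i
    using level_exponent_eq_0[OF assms(1) that] by (simp add: dyadic_label_eq_0)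
  then have "(\<forall>i<length (denominators m). dyadic_label m y i = dyadic_label m x i) \<longleftrightarrow>
      dyadic_label m y = dyadic_label m x"
    unfolding fun_eq_iff by (metis not_le)
  then show ?thesis
    by (simp add: open_cell_def *)
qed

lemma average_open_cell:
  assumes "integrable haar f" "1 \<le> m"
  shows "average f (open_cell m (dyadic_label m x)) = torus.cell_average m f x"
proof -
  let ?B = "open_cell m (dyadic_label m x)"
  have [measurable]: "f \<in> borel_measurable haar"
    using assms(1) by simp
  have cell: "torus.cell m x \<in> sets haar"
    by (rule torus.cell_in_sets) simp
  have ae: "AE y in haar. y \<in> torus.cell m x \<longleftrightarrow> y \<in> ?B"
    using AE_nondyadic
  proof eventually_elim
    case (elim y)
    then show ?case
      using nondyadic_mem_open_cell_iff[OF assms(2)] by (simp add: torus.cell_def)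
  qed
  have "(LINT y:?B|haar. f y) = (LINT y:torus.cell m x|haar. f y)"
  proof (rule set_integral_cong_set)
    show "AE y in haar. y \<in> torus.cell m x \<longleftrightarrow> y \<in> ?B"
      by (rule ae)
  qed (use cell in \<open>simp_all add: set_borel_measurable_def\<close>)
  moreover have "measure haar ?B = measure haar (torus.cell m x)"
    using ae cell by (intro measure_eq_AE) auto
  ultimately show ?thesis
    by (simp add: average_def torus.cell_average_def)
qed

text \<open>The numerators of the coordinates of \<open>t\<close> are the cell index. This trades
  translation on the circle for inequalities on coordinates, the form in which labels are
  defined.\<close>

lemma R0_eq_open_cells:
  "R0 = {open_cell m (\<lambda>i. int (a i)) | m a. 1 \<le> m \<and> (\<forall>i. a i < 2 ^ level_exponent m i)}"
proof -
  have translate: "(\<lambda>v. t + v) ` V m = open_cell m (\<lambda>i. int (a i))"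
    if m: "1 \<le> m" and a: "\<And>i. a i < 2 ^ level_exponent m i"
      and t: "\<And>i. i < length (denominators m) \<Longrightarrow> t i = circle_of (real (a i) / real (denominators m ! i))"
    for m t a
  proof -
    have "y i - t i \<in> circle_of ` {0<..<1 / real (denominators m ! i)} \<longleftrightarrow>
        real (a i) < 2 ^ level_exponent m i * coord (y i) \<and>
        2 ^ level_exponent m i * coord (y i) < real (a i) + 1"
      if "i < length (denominators m)" for y i
      using coord_translate_iff[of "denominators m ! i" "a i" "y i"] a[of i] t[OF that]
        nth_denominators[OF m that] by simp
    then have "y - t \<in> V m \<longleftrightarrow> y \<in> open_cell m (\<lambda>i. int (a i))" for y
      by (simp add: V_def box_open_def open_cell_def)
    moreover have "y \<in> (\<lambda>v. t + v) ` V m \<longleftrightarrow> y - t \<in> V m" for y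
      by (auto simp: image_iff) (metis add.commute diff_add_cancel)
    ultimately show ?thesis
      by blast
  qed
  show ?thesis
  proof (intro equalityI subsetI)
    fix B assume "B \<in> R0"
    then obtain m t where B: "B = (\<lambda>v. t + v) ` V m" and m: "1 \<le> m" and "t \<in> H m"
      by (auto simp: R0_def)
    then have "\<exists>a. a < 2 ^ level_exponent m i \<and> (i < length (denominators m) \<longrightarrow>
        t i = circle_of (real a / real (denominators m ! i)))" for i
    proof (cases "i < length (denominators m)")
      case True
      then have "t i \<in> R (denominators m ! i)"
        using \<open>t \<in> H m\<close> by (simp add: H_def box_subgroup_def)
      then show ?thesis
        using nth_denominators[OF m True] by (auto simp: R_def)
    next
      case False
      then show ?thesis
        by (intro exI[of _ 0]) simp
    qed
    then obtain a where "\<And>i. a i < 2 ^ level_exponent m i \<and> (i < length (denominators m) \<longrightarrow>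
        t i = circle_of (real (a i) / real (denominators m ! i)))"
      by metis
    then show "B \<in> {open_cell m (\<lambda>i. int (a i)) | m a. 1 \<le> m \<and> (\<forall>i. a i < 2 ^ level_exponent m i)}"
      using translate[OF m, of a t] B m by blast
  next
    fix B assume "B \<in> {open_cell m (\<lambda>i. int (a i)) | m a. 1 \<le> m \<and> (\<forall>i. a i < 2 ^ level_exponent m i)}"
    then obtain m a where B: "B = open_cell m (\<lambda>i. int (a i))" and m: "1 \<le> m"
      and a: "\<And>i. a i < 2 ^ level_exponent m i"
      by blast
    define t where "t i = (if i < length (denominators m)
      then circle_of (real (a i) / real (denominators m ! i)) else 0)" for i
    have "t \<in> H m"
      using a nth_denominators[OF m] by (auto simp: H_def box_subgroup_def R_def t_def)
    moreover have "B = (\<lambda>v. t + v) ` V m"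
      unfolding B by (rule translate[symmetric]) (use m a in \<open>auto simp: t_def\<close>)
    ultimately show "B \<in> R0"
      using m by (auto simp: R0_def)
  qed
qed

text \<open>A nondyadic point has an open neighbourhood missing every other cell of the same generation.\<close>

lemma basis_at_nondyadic:
  assumes x: "nondyadic x"
  shows "basis_at R0 x = {open_cell m (dyadic_label m x) | m. 1 \<le> m}"
proof (intro equalityI subsetI)
  fix B assume "B \<in> basis_at R0 x"
  then obtain m a where B: "B = open_cell m (\<lambda>i. int (a i))" and m: "1 \<le> m"
    and a: "\<And>i. a i < 2 ^ level_exponent m i" and cl: "x \<in> closure B"
    by (auto simp: basis_at_def R0_eq_open_cells)
  have "int (a i) = dyadic_label m x i" if i: "i < length (denominators m)" for i
  proof (rule ccontr)
    assume neq: "int (a i) \<noteq> dyadic_label m x i"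
    let ?k = "2 ^ level_exponent m i :: real"
    let ?l = "dyadic_label m x i"
    \<comment> \<open>The neighbourhood restricts only the coordinate \<open>i\<close> where the
      indices differ; it contains \<open>x\<close> because \<open>x\<close> is nondyadic, and
      intervals with different integer indices are disjoint.\<close>
    let ?I = "{c. of_int ?l / ?k < coord c \<and> coord c < (of_int ?l + 1) / ?k}"
    let ?U = "(\<lambda>y. y i) -` ?I :: torus set"
    have "open ?I"
    proof (rule open_coord_interval)
      show "0 \<le> of_int ?l / ?k"
        using dyadic_label_bounds(1)[of m x i] by simp
      have "?l + 1 \<le> 2 ^ level_exponent m i"
        using dyadic_label_bounds(2)[of m x i] by simp
      then have "of_int (?l + 1) \<le> (of_int (2 ^ level_exponent m i) :: real)"
        by (rule of_int_le_iff[THEN iffD2])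
      then show "(of_int ?l + 1) / ?k \<le> 1"
        by simp
    qed
    then have "open ?U"
      by (intro open_vimage) (auto intro: continuous_on_subset[OF continuous_on_product_coordinates])
    have U: "y \<in> ?U \<longleftrightarrow> of_int ?l < ?k * coord (y i) \<and> ?k * coord (y i) < of_int ?l + 1" for y
      by (auto simp: field_simps)
    have "x \<in> ?U"
      using x nondyadic_mem_open_cell_iff[OF m x, of x] i unfolding U by (simp add: open_cell_def)
    have "?U \<inter> B = {}"
    proof (rule ccontr)
      assume "?U \<inter> B \<noteq> {}"
      then obtain y where y: "y \<in> ?U" "y \<in> B" by blast
      have "of_int (int (a i)) < ?k * coord (y i)" "?k * coord (y i) < of_int (int (a i)) + 1"
        using y(2) i unfolding B open_cell_def by blast+
      with y(1)[unfolded U] have "int (a i) = ?l"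
        by linarith
      with neq show False ..
    qed
    then have "?U \<inter> closure B = {}"
      using open_Int_closure_eq_empty[OF \<open>open ?U\<close>] by blast
    with \<open>x \<in> ?U\<close> cl show False
      by blast
  qed
  then have "B = open_cell m (dyadic_label m x)"
    unfolding B open_cell_def by (metis (no_types, lifting))
  then show "B \<in> {open_cell m (dyadic_label m x) | m. 1 \<le> m}"
    using m by blast
next
  fix B assume "B \<in> {open_cell m (dyadic_label m x) | m. 1 \<le> m}"
  then obtain m where B: "B = open_cell m (dyadic_label m x)" and m: "1 \<le> m"
    by blast
  have "B = open_cell m (\<lambda>i. int (nat (dyadic_label m x i)))"
    using dyadic_label_bounds(1) by (simp add: B)
  moreover have "nat (dyadic_label m x i) < 2 ^ level_exponent m i" for i
    using dyadic_label_bounds[of m x i] by (simp add: nat_less_iff)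
  ultimately have "B \<in> R0"
    unfolding R0_eq_open_cells using m
    by (intro CollectI exI[of _ m] exI[of _ "\<lambda>i. nat (dyadic_label m x i)"]) simp
  moreover have "x \<in> B"
    unfolding B nondyadic_mem_open_cell_iff[OF m x] ..
  ultimately show "B \<in> basis_at R0 x"
    using closure_subset by (auto simp: basis_at_def)
qed

section \<open>Diameters of the cells and contracting sequences\<close>

text \<open>The coordinate just past the list of denominators is free, so moving it by half a turn
  stays in the cell.\<close>

lemma torus_diameter_open_cell_pos:
  assumes "x \<in> open_cell m a"
  shows "0 < torus_diameter (open_cell m a)"
proof -
  let ?N = "length (denominators m)"
  let ?y = "x(?N := x ?N - circle_of (1 / 2))"
  have "?y \<in> open_cell m a"
    using assms by (simp add: open_cell_def)
  moreover have "x ?N - ?y ?N = circle_of (1 / 2)"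
    by simp
  ultimately show ?thesis
    by (rule torus_diameter_pos[OF assms])
qed

text \<open>A free coordinate has exponent 0, and its bound 1 fits the same formula as the sides of
  the box.\<close>

lemma torus_diameter_open_cell_le:
  assumes m: "1 \<le> m" and x: "x \<in> open_cell m a"
  shows "torus_diameter (open_cell m a) \<le> (\<Sum>i. 1 / 2 ^ level_exponent m i / 2 ^ Suc i)"
proof (rule torus_diameter_le[OF x])
  fix y z assume yz: "y \<in> open_cell m a" "z \<in> open_cell m a"
  have le: "circle_norm (y i - z i) \<le> 1 / 2 ^ level_exponent m i" for i
  proof (cases "i < length (denominators m)")
    case True
    let ?k = "2 ^ level_exponent m i :: real"
    have "of_int (a i) < ?k * coord w \<and> ?k * coord w < of_int (a i) + 1" if "w \<in> {y i, z i}" for w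
      using yz True that by (auto simp: open_cell_def)
    from this[of "y i"] this[of "z i"]
    have "\<bar>?k * (coord (y i) - coord (z i))\<bar> \<le> 1"
      unfolding right_diff_distrib by auto
    then have "?k * \<bar>coord (y i) - coord (z i)\<bar> \<le> 1"
      by (simp add: abs_mult)
    then have "\<bar>coord (y i) - coord (z i)\<bar> \<le> 1 / ?k"
      by (simp add: pos_le_divide_eq mult.commute)
    with circle_norm_diff_le show ?thesis
      by (rule order_trans)
  next
    case False
    then have "level_exponent m i = 0"
      using m by (intro level_exponent_eq_0) auto
    then show ?thesis
      using order_trans[OF circle_norm_diff_le abs_coord_diff_le] by simp
  qed
  show "torus_dist y z \<le> (\<Sum>i. 1 / 2 ^ level_exponent m i / 2 ^ Suc i)"
    unfolding torus_dist_def
  proof (intro suminf_le summable_torus_dist)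
    show "circle_norm (y i - z i) / 2 ^ Suc i \<le> 1 / 2 ^ level_exponent m i / 2 ^ Suc i" for i
      using le by (rule divide_right_mono) simp
    show "summable (\<lambda>i. 1 / 2 ^ level_exponent m i / 2 ^ Suc i :: real)"
      by (rule summable_comparison_test'[OF summable_half_powers])
         (auto simp: divide_simps mult_ge1_I simp del: power_Suc)
  qed
qed

lemma torus_diameter_open_cells_tendsto:
  assumes x: "nondyadic x"
  shows "(\<lambda>m. torus_diameter (open_cell m (dyadic_label m x))) \<longlonglongrightarrow> 0"
proof (rule tendsto_sandwich)
  have mem: "x \<in> open_cell m (dyadic_label m x)" if "1 \<le> m" for m
    using nondyadic_mem_open_cell_iff[OF that x] by simp
  show "\<forall>\<^sub>F m in sequentially. 0 \<le> torus_diameter (open_cell m (dyadic_label m x))"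
    using eventually_ge_at_top[of 1]
    by eventually_elim (use mem torus_diameter_open_cell_pos less_imp_le in blast)
  show "\<forall>\<^sub>F m in sequentially. torus_diameter (open_cell m (dyadic_label m x))
      \<le> (\<Sum>i. 1 / 2 ^ level_exponent m i / 2 ^ Suc i)"
    using eventually_ge_at_top[of 1]
    by eventually_elim (use mem torus_diameter_open_cell_le in blast)
  \<comment> \<open>Each term tends to 0; Tannery's theorem with majorant
    \<open>1 / 2 ^ Suc i\<close> exchanges limit and sum.\<close>
  have lim: "(\<lambda>m. 1 / 2 ^ level_exponent m i / 2 ^ Suc i :: real) \<longlonglongrightarrow> 0 / 2 ^ Suc i" for i
    by (intro tendsto_divide inverse_power_level_exponent tendsto_const) simp
  have "\<forall>\<^sub>F (i, m) in at_top \<times>\<^sub>F sequentially.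
      norm (1 / 2 ^ level_exponent m i / 2 ^ Suc i :: real) \<le> 1 / 2 ^ Suc i"
    by (intro always_eventually) (auto simp: divide_simps mult_ge1_I simp del: power_Suc)
  from tannerys_theorem[OF lim this summable_half_powers]
  show "(\<lambda>m. \<Sum>i. 1 / 2 ^ level_exponent m i / 2 ^ Suc i :: real) \<longlonglongrightarrow> 0"
    by simp
qed simp

text \<open>A fixed generation contributes a single cell at \<open>x\<close>, of positive diameter,
  so diameters tending to 0 allow it only finitely often.\<close>

lemma contracting_nondyadic:
  assumes x: "nondyadic x" and B: "B \<in> contracting R0 x"
  obtains m where "\<And>n. B n = open_cell (m n) (dyadic_label (m n) x)" "\<And>n. 1 \<le> m n"
    "filterlim m at_top sequentially"
proof -
  have "\<exists>k\<ge>1. B n = open_cell k (dyadic_label k x)" for n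
  proof -
    have "B n \<in> basis_at R0 x"
      using B by (simp add: contracting_def)
    then show ?thesis
      unfolding basis_at_nondyadic[OF x] by blast
  qed
  then obtain m where m: "\<And>n. 1 \<le> m n" "\<And>n. B n = open_cell (m n) (dyadic_label (m n) x)"
    by metis
  have lim: "(\<lambda>n. torus_diameter (B n)) \<longlonglongrightarrow> 0"
    using B by (simp add: contracting_def)
  have "\<forall>\<^sub>F n in sequentially. m n \<noteq> k" if "1 \<le> k" for k
  proof -
    have "0 < torus_diameter (open_cell k (dyadic_label k x))"
      by (rule torus_diameter_open_cell_pos[of x])
         (simp add: nondyadic_mem_open_cell_iff[OF that x])
    from order_tendstoD(2)[OF lim this] show ?thesis
      by eventually_elim (auto simp: m(2))
  qed
  then have ev: "\<forall>\<^sub>F n in sequentially. \<forall>k\<in>{1..<N}. m n \<noteq> k" for N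
    by (intro eventually_ball_finite) auto
  have "\<forall>\<^sub>F n in sequentially. N \<le> m n" for N
    using ev[of N]
  proof eventually_elim
    case (elim n)
    then show ?case
      using m(1)[of n] by (metis atLeastLessThan_iff not_le)
  qed
  then have "filterlim m at_top sequentially"
    by (simp add: filterlim_at_top)
  with m(2,1) show thesis
    by (rule that)
qed

theorem corollary16:
  fixes f :: "torus \<Rightarrow> real"
  assumes "integrable haar f"
  shows "AE x in haar. upper_derivative R0 f x = ereal (f x)
    \<and> lower_derivative R0 f x = ereal (f x)"
  using AE_nondyadic torus.AE_cell_average_tendsto[OF assms]
proof eventually_elim
  case (elim x)
  have lim: "(\<lambda>n. ereal (average f (B n))) \<longlonglongrightarrow> ereal (f x)" if B: "B \<in> contracting R0 x" for B
  proof -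
    obtain m where m: "\<And>n. B n = open_cell (m n) (dyadic_label (m n) x)" "\<And>n. 1 \<le> m n"
      "filterlim m at_top sequentially"
      using contracting_nondyadic[OF elim(1) B] by blast
    have "(\<lambda>n. torus.cell_average (m n) f x) \<longlonglongrightarrow> f x"
      using elim(2) m(3) by (rule filterlim_compose)
    then show ?thesis
      by (simp add: m average_open_cell[OF assms m(2)])
  qed
  \<comment> \<open>A contracting sequence must exist, since over an empty family the supremum would
    be minus infinity and the infimum plus infinity. The shift by \<open>Suc\<close> starts at
    generation 1, as the basis does.\<close>
  have "(\<lambda>n. open_cell (Suc n) (dyadic_label (Suc n) x)) \<in> contracting R0 x"
    using basis_at_nondyadic[OF elim(1)]
      LIMSEQ_Suc[OF torus_diameter_open_cells_tendsto[OF elim(1)]]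
    by (auto simp: contracting_def)
  then have "contracting R0 x \<noteq> {}"
    by blast
  moreover have "limsup (\<lambda>n. ereal (average f (B n))) = ereal (f x)"
      "liminf (\<lambda>n. ereal (average f (B n))) = ereal (f x)" if "B \<in> contracting R0 x" for B
    using lim_imp_Limsup[OF _ lim[OF that]] lim_imp_Liminf[OF _ lim[OF that]] by simp_all
  ultimately show ?case
    by (simp add: upper_derivative_def lower_derivative_def)
qed

end
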